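(* Let $\mathcal{S}\subseteq\mathcal{N}=\{1,\dots,n\}$ be a sampling of $b$ nodes. Suppose that the LinDistFlow model accurately represents the network, i.e. the nodal voltage magnitudes are $v = v^\bullet\mathbf{1} + L^{-1}p$, where $L=(R+\kappa X)^{-1}=W\Lambda W^{\mathsf T}$. Suppose the nodal injections are $p=p_\star+\tilde p$, where $p_\star\in\mathbb{R}^n$ is a deterministic nominal value and $\tilde p_1,\dots,\tilde p_n$ are independent random variables satisfying $\underline{p}\le \tilde p_i\le \overline{p}$ almost surely for all $i$, and put $\Delta:=\overline{p}-\underline{p}>0$ (the width $\Delta$ being the same in every sampling round). Let $v_i^\bullet:=\mathbb{E}[v_i]$ for $i\in\mathcal N$. Then there is a universal constant $C>0$ such that $$\mathbb{E}\Big[\max_{i\in\mathcal{S}}|v_i-v_i^\bullet|\Big]\le C\cdot\tfrac12\,\Delta\,\max_{i\in\mathcal{S}}\|\Lambda^{-1}w_i\|_2\,\sqrt{2\log (b)};$$ moreover, for all $\epsilon>0$, $$\Pr\Big\{\max_{i\in\mathcal{S}}|v_i-v_i^\bullet|>\epsilon\Big\}\le 2b\exp\left\{\frac{-2\epsilon^2}{\Delta^2\max_{i\in\mathcal{S}}\|\Lambda^{-1}w_i\|_2^2}\right\}.$$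
   Context: A radial (tree) distribution network has a slack node, $n$ further nodes $\mathcal{N}=\{1,\dots,n\}$, and $n$ lines. $A\in\{-1,0,1\}^{n\times n}$ is the edge-to-node incidence matrix with the slack column removed; it is square because the network is a tree. $r,x\in\mathbb{R}^n$ are the vectors of line resistances and reactances, $R:=(A^{\mathsf T}\operatorname{diag}(r)^{-1}A)^{-1}$ and $X:=(A^{\mathsf T}\operatorname{diag}(x)^{-1}A)^{-1}$. The LinDistFlow approximation of the voltage magnitudes is $v=v^\bullet\mathbf{1}+Rp+Xq$, where $p,q\in\mathbb{R}^n$ are the active and reactive injections and the scalar $v^\bullet$ is the nominal slack voltage. The ratio $\kappa=q_i/p_i$ is the same real number for all nodes (so $q=\kappa p$). $L:=(R+\kappa X)^{-1}$ is real symmetric, with eigendecomposition $L=W\Lambda W^{\mathsf T}$, where $W\in\mathbb{R}^{n\times n}$ is orthogonal and $\Lambda=\operatorname{diag}(\lambda_1,\dots,\lambda_n)$. The vector $w_i\in\mathbb{R}^n$ is the $i$-th row of $W$ written as a column vector. Quantities refer to any one fixed sampling round.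
   Formalization: The expectation bound is stated only for b ≥ 2 (at b = 1, log b = 0 and it fails for nonconstant injections); C is formally chosen per sample-space type, but pushing forward the joint law of the injections to sequence space gives one universal C. *)

theory Defs
  imports
    "HOL-Probability.Probability"
    "Graph_Theory.Digraph_Component"
    "Jordan_Normal_Form.Gauss_Jordan_Elimination"
begin

unbundle no vec_syntax
no_notation inner (infix "\<bullet>" 70)
hide_const (open) Finite_Cartesian_Product.vec Finite_Cartesian_Product.row
  Finite_Cartesian_Product.mat
hide_type (open) Finite_Cartesian_Product.vec

section \<open>Matrices\<close>

definition mat_inv :: "real mat \<Rightarrow> real mat" where
  "mat_inv B = the (mat_inverse B)"

lemma mat_inv:
  assumes B: "B \<in> carrier_mat n n" and "invertible_mat B"
  shows "mat_inv B \<in> carrier_mat n n" "B * mat_inv B = 1\<^sub>m n" "mat_inv B * B = 1\<^sub>m n"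
proof -
  from assms obtain C where C: "B * C = 1\<^sub>m n" "C * B = 1\<^sub>m (dim_row C)"
    by (auto simp: invertible_mat_def inverts_mat_def)
  have "dim_col C = n" using arg_cong[OF C(1), of dim_col] by simp
  moreover have "dim_row C = n" using arg_cong[OF C(2), of dim_col] B by simp
  ultimately have "B \<in> Units (ring_mat TYPE(real) n undefined)"
    using B C by (auto simp: Units_def ring_mat_def)
  then obtain D where "mat_inverse B = Some D"
    using mat_inverse(1)[OF B, where b = undefined] by fastforce
  with mat_inverse(2)[OF B this] show
    "mat_inv B \<in> carrier_mat n n" "B * mat_inv B = 1\<^sub>m n" "mat_inv B * B = 1\<^sub>m n"
    by (simp_all add: mat_inv_def)
qed

lemma mat_inv_mat_inv:
  assumes B: "B \<in> carrier_mat n n" and inv: "invertible_mat B"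
  shows "mat_inv (mat_inv B) = B"
proof -
  note I = mat_inv[OF assms]
  have inv': "invertible_mat (mat_inv B)"
    using I B by (auto simp: invertible_mat_def inverts_mat_def)
  note J = mat_inv[OF I(1) inv']
  have "mat_inv (mat_inv B) = (B * mat_inv B) * mat_inv (mat_inv B)"
    using I J by simp
  also have "\<dots> = B * (mat_inv B * mat_inv (mat_inv B))"
    using I J B by (intro assoc_mult_mat)
  finally show ?thesis using J B by simp
qed

definition orthogonal_real_mat :: "nat \<Rightarrow> real mat \<Rightarrow> bool" where
  \<comment> \<open>The library's \<open>orthogonal_mat\<close> only asks for pairwise orthogonal nonzero columns,
     not for unit length.\<close>
  "orthogonal_real_mat n W \<longleftrightarrow>
     W \<in> carrier_mat n n \<and> W\<^sup>T * W = 1\<^sub>m n \<and> W * W\<^sup>T = 1\<^sub>m n"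

definition norm2 :: "real vec \<Rightarrow> real" where
  "norm2 u = L2_set (\<lambda>i. u $ i) {..<dim_vec u}"


section \<open>Radial networks and the LinDistFlow model\<close>

text \<open>
  A network is a digraph whose arcs are the lines, each carrying an arbitrary reference
  orientation. Since matrix indices start at 0, the \<open>n\<close> non-slack nodes are \<open>0, \<dots>, n - 1\<close>,
  the slack node is \<open>n\<close>, and the lines are \<open>0, \<dots>, n - 1\<close>.

  The library's \<open>forest\<close> excludes only directed cycles, so (say) a triangle with an acyclic
  orientation would count as a tree. Being radial concerns the underlying undirected
  multigraph: every line may be traversed in both directions, and a cycle is a cycle of this
  doubled digraph which uses no line twice.
\<close>

definition both_ways :: "('v, 'e) pre_digraph \<Rightarrow> ('v, 'e \<times> bool) pre_digraph" where
  "both_ways G = \<lparr> verts = verts G, arcs = arcs G \<times> UNIV,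
     tail = (\<lambda>(e, fwd). if fwd then tail G e else head G e),
     head = (\<lambda>(e, fwd). if fwd then head G e else tail G e) \<rparr>"

definition undirected_tree :: "('v, 'e) pre_digraph \<Rightarrow> bool" where
  "undirected_tree G \<longleftrightarrow> fin_digraph G \<and> Digraph_Component.connected G \<and>
     \<not> (\<exists>c. pre_digraph.cycle (both_ways G) c \<and> distinct (map fst c))"

definition radial_network :: "nat \<Rightarrow> (nat, nat) pre_digraph \<Rightarrow> bool" where
  "radial_network n G \<longleftrightarrow> undirected_tree G \<and> verts G = {..n} \<and> arcs G = {..<n}"

definition incidence_mat :: "nat \<Rightarrow> (nat, nat) pre_digraph \<Rightarrow> real mat" where
  \<comment> \<open>Rows are lines, columns are nodes; the column of the slack node \<open>n\<close> is left out.\<close>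
  "incidence_mat n G = mat n n (\<lambda>(l, j). of_bool (tail G l = j) - of_bool (head G l = j))"

definition network_mat :: "nat \<Rightarrow> (nat, nat) pre_digraph \<Rightarrow> real vec \<Rightarrow> real mat" where
  \<comment> \<open>This is \<open>R\<close> for the line resistances \<open>y = r\<close>, and \<open>X\<close> for the line reactances \<open>y = x\<close>.\<close>
  "network_mat n G y =
     mat_inv ((incidence_mat n G)\<^sup>T * mat_inv (mat_diag n (\<lambda>l. y $ l)) * incidence_mat n G)"

definition RkX_mat :: "nat \<Rightarrow> (nat, nat) pre_digraph \<Rightarrow> real vec \<Rightarrow> real vec \<Rightarrow> real \<Rightarrow> real mat" where
  "RkX_mat n G r x \<kappa> = network_mat n G r + \<kappa> \<cdot>\<^sub>m network_mat n G x"

definition L_mat :: "nat \<Rightarrow> (nat, nat) pre_digraph \<Rightarrow> real vec \<Rightarrow> real vec \<Rightarrow> real \<Rightarrow> real mat" where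
  "L_mat n G r x \<kappa> = mat_inv (RkX_mat n G r x \<kappa>)"

definition lindistflow ::
  "nat \<Rightarrow> (nat, nat) pre_digraph \<Rightarrow> real vec \<Rightarrow> real vec \<Rightarrow> real \<Rightarrow> real vec \<Rightarrow> real vec \<Rightarrow> real vec" where
  "lindistflow n G r x v\<^sub>0 p q =
     v\<^sub>0 \<cdot>\<^sub>v vec n (\<lambda>_. 1) + network_mat n G r *\<^sub>v p + network_mat n G x *\<^sub>v q"

lemma lindistflow_proportional:
  \<comment> \<open>For injections with \<open>q = \<kappa> p\<close>, the model takes the form \<open>v = v\<^sub>0 1 + L\<^sup>-\<^sup>1 p\<close>.\<close>
  assumes R: "network_mat n G r \<in> carrier_mat n n" and X: "network_mat n G x \<in> carrier_mat n n"
    and inv: "invertible_mat (RkX_mat n G r x \<kappa>)" and p: "p \<in> carrier_vec n"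
  shows "lindistflow n G r x v\<^sub>0 p (\<kappa> \<cdot>\<^sub>v p) =
    v\<^sub>0 \<cdot>\<^sub>v vec n (\<lambda>_. 1) + mat_inv (L_mat n G r x \<kappa>) *\<^sub>v p"
proof -
  have "RkX_mat n G r x \<kappa> \<in> carrier_mat n n" using R X by (simp add: RkX_mat_def)
  then have "mat_inv (L_mat n G r x \<kappa>) = RkX_mat n G r x \<kappa>"
    unfolding L_mat_def using inv by (rule mat_inv_mat_inv)
  moreover have "RkX_mat n G r x \<kappa> *\<^sub>v p = network_mat n G r *\<^sub>v p + network_mat n G x *\<^sub>v (\<kappa> \<cdot>\<^sub>v p)"
    using R X p
    by (intro eq_vecI) (auto simp: RkX_mat_def scalar_prod_def sum.distrib sum_distrib_left algebra_simps)
  ultimately show ?thesis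
    using R X p by (simp add: lindistflow_def assoc_add_vec[where n = n])
qed

end

theory Submission
  imports Defs
begin

text \<open>
  Orthogonality of \<open>W\<close> identifies \<open>norm2 (\<Lambda>\<^sup>-\<^sup>1 w\<^sub>i)\<close> with the Euclidean norm of the \<open>i\<close>-th row of
  \<open>L\<^sup>-\<^sup>1\<close>, so \<open>v\<^sub>i - E v\<^sub>i\<close> is a linear combination of centred, independent, bounded variables with
  these coefficients. The tail bound is Hoeffding's inequality and a union bound over \<open>S\<close>. For the
  expectation, Hoeffding's lemma makes each deviation sub-Gaussian with parameter
  \<open>\<sigma> = \<Delta> / 2 * norm2 (\<Lambda>\<^sup>-\<^sup>1 w\<^sub>i)\<close>. The maximum of the \<open>2 b\<close> variables \<open>\<plusminus> (v\<^sub>i - E v\<^sub>i)\<close> then has mean at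
  most \<open>\<sigma> * sqrt (2 * ln (2 * b))\<close>, and \<open>2 * b \<le> b\<^sup>2\<close> for \<open>b \<ge> 2\<close>, so \<open>C = sqrt 2\<close> works.
\<close>

section \<open>Sub-Gaussian variables\<close>

text \<open>Independence factors the expectation of the product of exponentials, and Hoeffding's
  lemma bounds each factor. The computation runs in nonnegative integrals, where factoring
  presupposes no integrability; the finite bound then yields integrability and transfers to
  \<open>expectation\<close>.\<close>

lemma (in indep_interval_bounded_random_variables) sum_mgf_bound:
  assumes "l > 0"
  defines "Z \<equiv> \<lambda>\<omega>. \<Sum>i\<in>I. X i \<omega> - expectation (X i)"
  shows "integrable M (\<lambda>\<omega>. exp (l * Z \<omega>))"
    and "expectation (\<lambda>\<omega>. exp (l * Z \<omega>)) \<le> exp (l\<^sup>2 * (\<Sum>i\<in>I. (b i - a i)\<^sup>2) / 8)"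
proof -
  have meas: "(\<lambda>\<omega>. exp (l * Z \<omega>)) \<in> borel_measurable M"
    unfolding Z_def by measurable
  have "(\<integral>\<^sup>+\<omega>. ennreal (exp (l * Z \<omega>)) \<partial>M) =
      (\<integral>\<^sup>+\<omega>. (\<Prod>i\<in>I. ennreal (exp (l * (X i \<omega> - expectation (X i))))) \<partial>M)"
    unfolding Z_def by (simp add: sum_distrib_left exp_sum fin prod_ennreal)
  also have "\<dots> = (\<Prod>i\<in>I. \<integral>\<^sup>+\<omega>. ennreal (exp (l * (X i \<omega> - expectation (X i)))) \<partial>M)"
    by (intro indep_vars_nn_integral fin indep_vars_compose2[OF indep]) auto
  also have "\<dots> \<le> (\<Prod>i\<in>I. ennreal (exp (l\<^sup>2 * (b i - a i)\<^sup>2 / 8)))"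
  proof (intro prod_mono_ennreal)
    fix i assume "i \<in> I"
    then interpret interval_bounded_random_variable M "X i" "a i" "b i" ..
    show "(\<integral>\<^sup>+\<omega>. ennreal (exp (l * (X i \<omega> - expectation (X i)))) \<partial>M)
        \<le> ennreal (exp (l\<^sup>2 * (b i - a i)\<^sup>2 / 8))"
      by (rule Hoeffdings_lemma_nn_integral) fact
  qed
  also have "\<dots> = ennreal (exp (l\<^sup>2 * (\<Sum>i\<in>I. (b i - a i)\<^sup>2) / 8))"
    by (simp add: prod_ennreal sum_distrib_left sum_divide_distrib exp_sum fin)
  finally have le: "(\<integral>\<^sup>+\<omega>. ennreal (exp (l * Z \<omega>)) \<partial>M)
      \<le> ennreal (exp (l\<^sup>2 * (\<Sum>i\<in>I. (b i - a i)\<^sup>2) / 8))" .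
  have "(\<integral>\<^sup>+\<omega>. ennreal (norm (exp (l * Z \<omega>))) \<partial>M) < \<infinity>"
    using le by (simp add: le_less_trans)
  then show int: "integrable M (\<lambda>\<omega>. exp (l * Z \<omega>))"
    by (intro integrableI_bounded meas)
  have "ennreal (expectation (\<lambda>\<omega>. exp (l * Z \<omega>))) = (\<integral>\<^sup>+\<omega>. ennreal (exp (l * Z \<omega>)) \<partial>M)"
    by (intro nn_integral_eq_integral[symmetric] int) auto
  with le have "ennreal (expectation (\<lambda>\<omega>. exp (l * Z \<omega>)))
      \<le> ennreal (exp (l\<^sup>2 * (\<Sum>i\<in>I. (b i - a i)\<^sup>2) / 8))"
    by (simp only:)
  then show "expectation (\<lambda>\<omega>. exp (l * Z \<omega>)) \<le> exp (l\<^sup>2 * (\<Sum>i\<in>I. (b i - a i)\<^sup>2) / 8)"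
    by simp
qed

text \<open>The graph of exp lies above its tangent at \<open>ln c\<close>. Taking expectations with
  \<open>c\<close> an upper bound for the mean of \<open>exp y\<close> bounds the mean of
  \<open>y\<close> by \<open>ln c\<close>, so this pointwise inequality stands in for Jensen's
  inequality.\<close>

lemma le_exp_divide_add_ln:
  fixes y c :: real
  assumes "c > 0"
  shows "y \<le> exp y / c + ln c - 1"
  using exp_ge_add_one_self[of "y - ln c"] assms by (simp add: exp_diff)

text \<open>The exponential of a scaled maximum is at most the sum of the exponentials of all
  \<open>2 * card S\<close> signed variables, whose mean is controlled by the moment bounds. No
  independence between different indices of \<open>S\<close> enters, which matters because all nodal
  voltages depend on the same injections.\<close>

lemma (in prob_space) expectation_Max_abs_le:
  fixes Z :: "'i \<Rightarrow> 'a \<Rightarrow> real"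
  assumes S: "finite S" "S \<noteq> {}" and s: "s > 0"
    and int: "\<And>i l. i \<in> S \<Longrightarrow> l > 0 \<Longrightarrow> integrable M (\<lambda>\<omega>. exp (l * Z i \<omega>))"
      "\<And>i l. i \<in> S \<Longrightarrow> l > 0 \<Longrightarrow> integrable M (\<lambda>\<omega>. exp (l * - Z i \<omega>))"
    and mgf: "\<And>i l. i \<in> S \<Longrightarrow> l > 0 \<Longrightarrow> expectation (\<lambda>\<omega>. exp (l * Z i \<omega>)) \<le> exp (l\<^sup>2 * s\<^sup>2 / 2)"
      "\<And>i l. i \<in> S \<Longrightarrow> l > 0 \<Longrightarrow> expectation (\<lambda>\<omega>. exp (l * - Z i \<omega>)) \<le> exp (l\<^sup>2 * s\<^sup>2 / 2)"
  shows "expectation (\<lambda>\<omega>. MAX i\<in>S. \<bar>Z i \<omega>\<bar>) \<le> s * sqrt (2 * ln (2 * card S))"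
proof -
  define B where "B = 2 * real (card S)"
  have B: "B \<ge> 2" using S by (simp add: B_def Suc_leI card_gt_0_iff)
  define q where "q = sqrt (2 * ln B)"
  have q: "q > 0" "q\<^sup>2 = 2 * ln B" using B by (auto simp: q_def)
  \<comment> \<open>This \<open>l\<close> minimizes \<open>ln B / l + l * s^2 / 2\<close>, the bound
    that the exponential moments give; the minimum is \<open>s * q\<close>. Since \<open>B\<close>
    is at least 2, \<open>q\<close> and hence \<open>l\<close> are positive.\<close>
  define l where "l = q / s"
  have l: "l > 0" using q s by (simp add: l_def)
  \<comment> \<open>An upper bound for the mean of the sum of exponentials, so the quotient in
    \<open>g\<close> has mean at most 1 and cancels the final \<open>- 1\<close>.\<close>
  define c where "c = B * exp (l\<^sup>2 * s\<^sup>2 / 2)"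
  have c: "c > 0" using B by (simp add: c_def)
  define g where "g = (\<lambda>\<omega>. (\<Sum>i\<in>S. exp (l * Z i \<omega>) + exp (l * - Z i \<omega>)) / c + ln c - 1)"
  have int_g: "integrable M g"
    unfolding g_def using int l by (auto intro!: Bochner_Integration.integrable_sum)
  have "expectation g =
      (\<Sum>i\<in>S. expectation (\<lambda>\<omega>. exp (l * Z i \<omega>)) + expectation (\<lambda>\<omega>. exp (l * - Z i \<omega>))) / c
      + ln c - 1"
    unfolding g_def using int l
    by (simp add: Bochner_Integration.integral_sum Bochner_Integration.integral_add prob_space del: mult_minus_right)
  also have "\<dots> \<le> (\<Sum>i\<in>S. exp (l\<^sup>2 * s\<^sup>2 / 2) + exp (l\<^sup>2 * s\<^sup>2 / 2)) / c + ln c - 1"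
    using mgf l c by (intro add_right_mono diff_right_mono divide_right_mono sum_mono add_mono) auto
  also have "\<dots> = ln c"
    using S by (simp add: c_def B_def card_gt_0_iff)
  also have "\<dots> = ln B + l\<^sup>2 * s\<^sup>2 / 2"
    using B by (simp add: c_def ln_mult)
  also have "\<dots> = q\<^sup>2"
    using q s by (simp add: l_def power_divide)
  finally have E_g: "expectation g \<le> q\<^sup>2" .
  have le_g: "l * (MAX i\<in>S. \<bar>Z i \<omega>\<bar>) \<le> g \<omega>" for \<omega>
  proof -
    obtain i where i: "i \<in> S" "(MAX i\<in>S. \<bar>Z i \<omega>\<bar>) = \<bar>Z i \<omega>\<bar>"
      using Max_in[of "(\<lambda>i. \<bar>Z i \<omega>\<bar>) ` S"] S unfolding image_iff by blast
    have "exp (l * \<bar>Z i \<omega>\<bar>) \<le> exp (l * Z i \<omega>) + exp (l * - Z i \<omega>)"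
      by (simp add: abs_if)
    also have "\<dots> \<le> (\<Sum>i\<in>S. exp (l * Z i \<omega>) + exp (l * - Z i \<omega>))"
      using S i by (intro member_le_sum) auto
    finally have "exp (l * \<bar>Z i \<omega>\<bar>) / c \<le> (\<Sum>i\<in>S. exp (l * Z i \<omega>) + exp (l * - Z i \<omega>)) / c"
      using c by (intro divide_right_mono) auto
    with le_exp_divide_add_ln[OF c, of "l * \<bar>Z i \<omega>\<bar>"] show ?thesis
      by (simp add: i g_def)
  qed
  have Max_nonneg: "0 \<le> (MAX i\<in>S. \<bar>Z i \<omega>\<bar>)" for \<omega>
    using S by (force simp: Max_ge_iff)
  \<comment> \<open>\<open>integral_mono'\<close> asks only for an integrable nonnegative majorant:
    were the maximum not integrable, its integral would be 0 by convention.\<close>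
  have g_nonneg: "0 \<le> g \<omega>" for \<omega>
    using le_g[of \<omega>] Max_nonneg[of \<omega>] l by (meson mult_nonneg_nonneg order.trans less_imp_le)
  have "expectation (\<lambda>\<omega>. l * (MAX i\<in>S. \<bar>Z i \<omega>\<bar>)) \<le> expectation g"
    by (rule integral_mono') (use int_g le_g g_nonneg in auto)
  with E_g have "l * expectation (\<lambda>\<omega>. MAX i\<in>S. \<bar>Z i \<omega>\<bar>) \<le> q\<^sup>2"
    by simp
  then have "expectation (\<lambda>\<omega>. MAX i\<in>S. \<bar>Z i \<omega>\<bar>) \<le> q\<^sup>2 / l"
    using l by (simp add: field_simps)
  also have "\<dots> = s * q"
    using q(1) by (simp add: l_def power2_eq_square)
  finally show ?thesis unfolding q_def B_def by simp
qed

lemma scaled_mem_interval: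
  fixes c x lo hi :: real
  assumes "lo \<le> x" "x \<le> hi"
  shows "c * x \<in> {min (c * lo) (c * hi)..max (c * lo) (c * hi)}"
proof (cases "c \<ge> 0")
  case True
  then have "c * lo \<le> c * x" "c * x \<le> c * hi" using assms by (auto intro: mult_left_mono)
  then show ?thesis by auto
next
  case False
  then have "c * hi \<le> c * x" "c * x \<le> c * lo" using assms by (auto intro: mult_left_mono_neg)
  then show ?thesis by auto
qed

section \<open>Linear combinations of independent variables with a common range\<close>

locale indep_common_interval = prob_space +
  fixes I :: "'b set" and X :: "'b \<Rightarrow> 'a \<Rightarrow> real" and lo hi :: real
  assumes fin: "finite I"
    and indep: "indep_vars (\<lambda>_. borel) X I"
    and interval: "\<And>i. i \<in> I \<Longrightarrow> AE \<omega> in M. lo \<le> X i \<omega> \<and> X i \<omega> \<le> hi"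
    and width: "lo < hi"
begin

text \<open>Centring term by term matches the sum in \<open>sum_mgf_bound\<close>; by linearity this
  is the linear combination minus its mean.\<close>

definition deviation :: "('b \<Rightarrow> real) \<Rightarrow> 'a \<Rightarrow> real" where
  "deviation c \<omega> = (\<Sum>i\<in>I. c i * X i \<omega> - expectation (\<lambda>\<omega>. c i * X i \<omega>))"

lemma measurable_X [measurable]: "i \<in> I \<Longrightarrow> X i \<in> borel_measurable M"
  using indep unfolding indep_vars_def by blast

lemma integrable_X: "i \<in> I \<Longrightarrow> integrable M (X i)"
  by (rule integrable_const_bound[where B = "max \<bar>lo\<bar> \<bar>hi\<bar>"])
    (auto intro: eventually_mono[OF interval])

text \<open>Turns the lower side of a deviation into the upper side for negated coefficients, so one
  moment bound serves both signs.\<close>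

lemma deviation_uminus: "deviation (\<lambda>i. - c i) \<omega> = - deviation c \<omega>"
  by (simp add: deviation_def flip: sum_negf)

lemma measurable_deviation [measurable]: "deviation c \<in> borel_measurable M"
  unfolding deviation_def by measurable

text \<open>A negative coefficient swaps the endpoints of the scaled interval; \<open>min\<close>
  and \<open>max\<close> put them in order without splitting on signs.\<close>

lemma bounded_scaled:
  "indep_interval_bounded_random_variables M I (\<lambda>i \<omega>. c i * X i \<omega>)
     (\<lambda>i. min (c i * lo) (c i * hi)) (\<lambda>i. max (c i * lo) (c i * hi))"
proof
  show "indep_vars (\<lambda>_. borel) (\<lambda>i \<omega>. c i * X i \<omega>) I"
    by (rule indep_vars_compose2[OF indep]) auto
  fix i assume "i \<in> I"
  show "AE \<omega> in M. c i * X i \<omega> \<in> {min (c i * lo) (c i * hi)..max (c i * lo) (c i * hi)}"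
    using interval[OF \<open>i \<in> I\<close>] by eventually_elim (auto intro!: scaled_mem_interval simp del: atLeastAtMost_iff)
qed (rule fin)

text \<open>Squaring removes the order of the endpoints, so each squared width is
  \<open>(hi - lo)^2 * (c i)^2\<close>. This is how the Euclidean norm of the coefficients
  enters.\<close>

lemma sum_widths:
  "(\<Sum>i\<in>I. (max (c i * lo) (c i * hi) - min (c i * lo) (c i * hi))\<^sup>2) = (hi - lo)\<^sup>2 * (L2_set c I)\<^sup>2"
proof -
  have "(max u v - min u v)\<^sup>2 = (v - u)\<^sup>2" for u v :: real
    by (simp add: max_def min_def power2_commute)
  then have "(max (c i * lo) (c i * hi) - min (c i * lo) (c i * hi))\<^sup>2 = (hi - lo)\<^sup>2 * (c i)\<^sup>2" for i
    by (simp add: power_mult_distrib flip: right_diff_distrib)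
  then show ?thesis
    by (simp add: L2_set_def sum_nonneg sum_distrib_left)
qed

text \<open>Rewriting the exponent from a division by 8 to a division by 2 exhibits the sub-Gaussian
  parameter \<open>(hi - lo) / 2 * L2_set c I\<close>.\<close>

lemma deviation_mgf_bound:
  assumes "l > 0"
  shows "integrable M (\<lambda>\<omega>. exp (l * deviation c \<omega>))"
    and "expectation (\<lambda>\<omega>. exp (l * deviation c \<omega>)) \<le> exp (l\<^sup>2 * ((hi - lo) / 2 * L2_set c I)\<^sup>2 / 2)"
proof -
  interpret scaled: indep_interval_bounded_random_variables M I "\<lambda>i \<omega>. c i * X i \<omega>"
    "\<lambda>i. min (c i * lo) (c i * hi)" "\<lambda>i. max (c i * lo) (c i * hi)"
    by (rule bounded_scaled)
  show "integrable M (\<lambda>\<omega>. exp (l * deviation c \<omega>))"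
    unfolding deviation_def using scaled.sum_mgf_bound(1)[OF assms] .
  show "expectation (\<lambda>\<omega>. exp (l * deviation c \<omega>)) \<le> exp (l\<^sup>2 * ((hi - lo) / 2 * L2_set c I)\<^sup>2 / 2)"
    using scaled.sum_mgf_bound(2)[OF assms]
    unfolding deviation_def sum_widths by (simp add: power_mult_distrib power_divide)
qed

lemma deviation_tail_bound:
  assumes "\<epsilon> \<ge> 0" and "L2_set c I > 0"
  shows "prob {\<omega> \<in> space M. \<bar>deviation c \<omega>\<bar> \<ge> \<epsilon>} \<le> 2 * exp (- 2 * \<epsilon>\<^sup>2 / ((hi - lo)\<^sup>2 * (L2_set c I)\<^sup>2))"
proof -
  interpret scaled: indep_interval_bounded_random_variables M I "\<lambda>i \<omega>. c i * X i \<omega>"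
    "\<lambda>i. min (c i * lo) (c i * hi)" "\<lambda>i. max (c i * lo) (c i * hi)"
    by (rule bounded_scaled)
  interpret scaled: Hoeffding_ineq M I "\<lambda>i \<omega>. c i * X i \<omega>"
    "\<lambda>i. min (c i * lo) (c i * hi)" "\<lambda>i. max (c i * lo) (c i * hi)"
    "\<Sum>i\<in>I. expectation (\<lambda>\<omega>. c i * X i \<omega>)"
    by unfold_locales auto
  have "(hi - lo)\<^sup>2 * (L2_set c I)\<^sup>2 > 0"
    using width assms(2) by simp
  then show ?thesis
    using scaled.Hoeffding_ineq_abs_ge[OF assms(1)]
    unfolding sum_widths deviation_def by (simp add: sum_subtractf)
qed

lemma Max_deviation_expectation_bound:
  assumes S: "finite S" "card S \<ge> 2" and pos: "\<And>j. j \<in> S \<Longrightarrow> L2_set (c j) I > 0"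
  shows "expectation (\<lambda>\<omega>. MAX j\<in>S. \<bar>deviation (c j) \<omega>\<bar>)
    \<le> sqrt 2 * (1/2 * (hi - lo) * (MAX j\<in>S. L2_set (c j) I) * sqrt (2 * ln (card S)))"
proof -
  have ne: "S \<noteq> {}" using S by auto
  \<comment> \<open>The largest individual parameter serves as the common one that
    \<open>expectation_Max_abs_le\<close> takes.\<close>
  define s where "s = (hi - lo) / 2 * (MAX j\<in>S. L2_set (c j) I)"
  have "(MAX j\<in>S. L2_set (c j) I) > 0"
    using pos S(1) ne by (subst Max_gr_iff) auto
  then have s: "s > 0"
    using width by (simp add: s_def)
  have le_s: "(hi - lo) / 2 * L2_set (c j) I \<le> s" if "j \<in> S" for j
    using that width S(1) unfolding s_def by (intro mult_left_mono Max_ge) auto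
  have exp_le: "exp (l\<^sup>2 * ((hi - lo) / 2 * L2_set (c j) I)\<^sup>2 / 2) \<le> exp (l\<^sup>2 * s\<^sup>2 / 2)"
    if "j \<in> S" for j and l :: real
  proof -
    have "((hi - lo) / 2 * L2_set (c j) I)\<^sup>2 \<le> s\<^sup>2"
      using le_s[OF that] width by (intro power_mono) auto
    then show ?thesis
      unfolding exp_le_cancel_iff by (intro divide_right_mono mult_left_mono) auto
  qed
  note minus = deviation_uminus[symmetric]
  have L2_minus: "L2_set (\<lambda>i. - f i) I = L2_set f I" for f :: "'b \<Rightarrow> real"
    by (simp add: L2_set_def)
  have "expectation (\<lambda>\<omega>. MAX j\<in>S. \<bar>deviation (c j) \<omega>\<bar>) \<le> s * sqrt (2 * ln (2 * card S))"
  proof (rule expectation_Max_abs_le[OF S(1) ne s])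
    fix j and l :: real assume *: "j \<in> S" "l > 0"
    show "integrable M (\<lambda>\<omega>. exp (l * deviation (c j) \<omega>))"
      "integrable M (\<lambda>\<omega>. exp (l * - deviation (c j) \<omega>))"
      unfolding minus by (rule deviation_mgf_bound(1)[OF *(2)])+
    show "expectation (\<lambda>\<omega>. exp (l * deviation (c j) \<omega>)) \<le> exp (l\<^sup>2 * s\<^sup>2 / 2)"
      using deviation_mgf_bound(2)[OF *(2)] exp_le[OF *(1)] by (rule order.trans)
    show "expectation (\<lambda>\<omega>. exp (l * - deviation (c j) \<omega>)) \<le> exp (l\<^sup>2 * s\<^sup>2 / 2)"
      unfolding minus
      using deviation_mgf_bound(2)[OF *(2), of "\<lambda>i. - c j i"] exp_le[OF *(1), of l]
      unfolding L2_minus by (rule order.trans)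
  qed
  also have "\<dots> \<le> s * sqrt (2 * (2 * ln (card S)))"
  proof -
    \<comment> \<open>This is where \<open>card S >= 2\<close> enters. For a singleton,
      \<open>ln (card S)\<close> is 0, and no constant factor could absorb the \<open>ln 2\<close>
      from the two signs.\<close>
    have "ln (2 * real (card S)) \<le> ln (real (card S) * real (card S))"
      using S by (intro ln_mono mult_right_mono) auto
    then show ?thesis using S s by (simp add: ln_mult)
  qed
  also have "\<dots> = sqrt 2 * (1/2 * (hi - lo) * (MAX j\<in>S. L2_set (c j) I) * sqrt (2 * ln (card S)))"
    by (simp add: s_def real_sqrt_mult)
  finally show ?thesis .
qed

lemma Max_deviation_tail_bound:
  assumes S: "finite S" "S \<noteq> {}" and pos: "\<And>j. j \<in> S \<Longrightarrow> L2_set (c j) I > 0" and \<epsilon>: "\<epsilon> \<ge> 0"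
  shows "prob {\<omega> \<in> space M. (MAX j\<in>S. \<bar>deviation (c j) \<omega>\<bar>) > \<epsilon>}
    \<le> 2 * real (card S) * exp (- 2 * \<epsilon>\<^sup>2 / ((hi - lo)\<^sup>2 * (MAX j\<in>S. L2_set (c j) I)\<^sup>2))"
proof -
  let ?m = "MAX j\<in>S. L2_set (c j) I"
  let ?A = "\<lambda>j. {\<omega> \<in> space M. \<bar>deviation (c j) \<omega>\<bar> \<ge> \<epsilon>}"
  have meas: "?A ` S \<subseteq> events" by auto
  \<comment> \<open>A maximum exceeding the threshold is attained by some index; the strict
    inequality is weakened to match Hoeffding's inequality.\<close>
  have "{\<omega> \<in> space M. (MAX j\<in>S. \<bar>deviation (c j) \<omega>\<bar>) > \<epsilon>} \<subseteq> (\<Union>j\<in>S. ?A j)"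
    using S by (auto simp: Max_gr_iff intro: less_imp_le)
  then have "prob {\<omega> \<in> space M. (MAX j\<in>S. \<bar>deviation (c j) \<omega>\<bar>) > \<epsilon>} \<le> prob (\<Union>j\<in>S. ?A j)"
    using S(1) by (intro finite_measure_mono) auto
  also have "\<dots> \<le> (\<Sum>j\<in>S. prob (?A j))"
    by (rule finite_measure_subadditive_finite[OF S(1) meas])
  also have "\<dots> \<le> (\<Sum>j\<in>S. 2 * exp (- 2 * \<epsilon>\<^sup>2 / ((hi - lo)\<^sup>2 * ?m\<^sup>2)))"
  proof (rule sum_mono)
    fix j assume j: "j \<in> S"
    \<comment> \<open>Replacing each norm by the largest one enlarges the denominator and so weakens
      the bound to one common to all of \<open>S\<close>.\<close>
    have "L2_set (c j) I \<le> ?m" using S(1) j by (intro Max_ge) auto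
    then have "(hi - lo)\<^sup>2 * (L2_set (c j) I)\<^sup>2 \<le> (hi - lo)\<^sup>2 * ?m\<^sup>2"
      using pos[OF j] by (intro mult_left_mono power_mono) auto
    moreover have "0 < (hi - lo)\<^sup>2 * (L2_set (c j) I)\<^sup>2"
      using pos[OF j] width by simp
    ultimately have "2 * \<epsilon>\<^sup>2 / ((hi - lo)\<^sup>2 * ?m\<^sup>2) \<le> 2 * \<epsilon>\<^sup>2 / ((hi - lo)\<^sup>2 * (L2_set (c j) I)\<^sup>2)"
      by (intro divide_left_mono) auto
    then show "prob (?A j) \<le> 2 * exp (- 2 * \<epsilon>\<^sup>2 / ((hi - lo)\<^sup>2 * ?m\<^sup>2))"
      using deviation_tail_bound[OF \<epsilon> pos[OF j]] by (simp add: order.trans)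
  qed
  finally show ?thesis by simp
qed

end


section \<open>Rows of the inverse\<close>

lemma mat_inv_eqI:
  assumes B: "B \<in> carrier_mat n n" and C: "C \<in> carrier_mat n n"
    and BC: "B * C = 1\<^sub>m n" and CB: "C * B = 1\<^sub>m n"
  shows "mat_inv B = C"
proof -
  have inv: "invertible_mat B"
    using assms by (auto simp: invertible_mat_def inverts_mat_def)
  note I = mat_inv[OF B inv]
  have "mat_inv B = (C * B) * mat_inv B" using CB I by simp
  also have "\<dots> = C * (B * mat_inv B)" using B C I by (intro assoc_mult_mat)
  finally show ?thesis using I C by simp
qed

lemma invertible_mat_inv:
  assumes "B \<in> carrier_mat n n" "invertible_mat B"
  shows "invertible_mat (mat_inv B)"
  using mat_inv[OF assms] assms(1) by (auto simp: invertible_mat_def inverts_mat_def)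

text \<open>The squared norm of row \<open>i\<close> is the diagonal entry \<open>(i, i)\<close> of
  a matrix times its transpose, and in that product for \<open>Q * W\<^sup>T\<close> the inner
  \<open>W\<^sup>T * W\<close> cancels.\<close>

lemma norm2_row_mult_transpose:
  assumes Q: "Q \<in> carrier_mat n n" and W: "orthogonal_real_mat n W" and i: "i < n"
  shows "norm2 (row (Q * W\<^sup>T) i) = norm2 (row Q i)"
proof -
  have W': "W \<in> carrier_mat n n" "W\<^sup>T * W = 1\<^sub>m n"
    using W by (auto simp: orthogonal_real_mat_def)
  have norm2_row: "norm2 (row B i) = sqrt ((B * B\<^sup>T) $$ (i, i))" if "B \<in> carrier_mat n n" for B
    using that i by (simp add: norm2_def L2_set_def scalar_prod_def power2_eq_square atLeast0LessThan)
  have T: "(Q * W\<^sup>T)\<^sup>T = W * Q\<^sup>T"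
    using Q W' by (subst transpose_mult) auto
  have "(Q * W\<^sup>T) * (Q * W\<^sup>T)\<^sup>T = Q * (W\<^sup>T * (W * Q\<^sup>T))"
    unfolding T using Q W' by (intro assoc_mult_mat) auto
  also have "W\<^sup>T * (W * Q\<^sup>T) = (W\<^sup>T * W) * Q\<^sup>T"
    using Q W' by (intro assoc_mult_mat[symmetric]) auto
  also have "\<dots> = Q\<^sup>T"
    using Q W' by simp
  finally show ?thesis
    using Q W' by (simp add: norm2_row)
qed

lemma transpose_mat_diag: "(mat_diag n f)\<^sup>T = mat_diag n f"
  by (intro eq_matI) (auto simp: mat_diag_def)

text \<open>Transposing the two inverse identities makes the transposed inverse another two-sided
  inverse of \<open>B\<close>. Applied to the diagonal factor, it avoids computing the entries of
  the inverse.\<close>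

lemma mat_inv_symmetric:
  assumes B: "B \<in> carrier_mat n n" "invertible_mat B" and sym: "B\<^sup>T = B"
  shows "(mat_inv B)\<^sup>T = mat_inv B"
proof -
  note I = mat_inv[OF B]
  have "B * (mat_inv B)\<^sup>T = (mat_inv B * B)\<^sup>T" "(mat_inv B)\<^sup>T * B = (B * mat_inv B)\<^sup>T"
    by (simp_all only: transpose_mult[OF I(1) B(1)] transpose_mult[OF B(1) I(1)] sym)
  then show ?thesis
    using I B(1) by (intro mat_inv_eqI[symmetric]) simp_all
qed

lemma conjugate_conjugate_mat:
  fixes P :: "real mat"
  assumes P: "P \<in> carrier_mat n n" "P' \<in> carrier_mat n n" "P * P' = 1\<^sub>m n"
    and A: "A \<in> carrier_mat n n"
  shows "P * (P' * A * P) * P' = A"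
proof -
  have "P * (P' * A * P) * P' = (P * P') * A * (P * P')"
    using P(1,2) A by (simp add: assoc_mult_mat[of _ n n _ n _ n])
  then show ?thesis using P(3) A by simp
qed

text \<open>The inner \<open>P * P'\<close> cancels, so conjugation is multiplicative; in particular
  it carries inverse pairs to inverse pairs.\<close>

lemma conjugate_mult_mat:
  fixes P :: "real mat"
  assumes P: "P \<in> carrier_mat n n" "P' \<in> carrier_mat n n" "P * P' = 1\<^sub>m n"
    and AB: "A \<in> carrier_mat n n" "B \<in> carrier_mat n n"
  shows "(P' * A * P) * (P' * B * P) = P' * (A * B) * P"
proof -
  have "(P' * A * P) * (P' * B * P) = P' * A * (P * P') * (B * P)"
    using P(1,2) AB by (simp add: assoc_mult_mat[of _ n n _ n _ n])
  also have "\<dots> = P' * A * (B * P)" using P AB by simp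
  finally show ?thesis
    using P(1,2) AB by (simp add: assoc_mult_mat[of _ n n _ n _ n])
qed

text \<open>Conjugating back gives \<open>D\<close> from the product, and the same conjugation of
  the product's inverse is a two-sided inverse of \<open>D\<close>. Invertibility of the eigenvalue
  matrix is thus inherited from that of the diagonalized matrix.\<close>

lemma orthogonally_similar_inverse:
  assumes W: "orthogonal_real_mat n W" and D: "D \<in> carrier_mat n n"
    and inv: "invertible_mat (W * D * W\<^sup>T)"
  shows "invertible_mat D" "mat_inv (W * D * W\<^sup>T) = W * mat_inv D * W\<^sup>T"
proof -
  have W': "W \<in> carrier_mat n n" "W\<^sup>T \<in> carrier_mat n n" "W\<^sup>T * W = 1\<^sub>m n" "W * W\<^sup>T = 1\<^sub>m n"
    using W by (auto simp: orthogonal_real_mat_def)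
  define L where "L = W * D * W\<^sup>T"
  have L: "L \<in> carrier_mat n n" using W' D by (simp add: L_def)
  note I = mat_inv[OF L inv[folded L_def]]
  define E where "E = W\<^sup>T * mat_inv L * W"
  have E: "E \<in> carrier_mat n n" using W' I by (simp add: E_def)
  have D_eq: "D = W\<^sup>T * L * W"
    unfolding L_def using conjugate_conjugate_mat[OF W'(2,1,3) D] by simp
  have DE: "D * E = 1\<^sub>m n" "E * D = 1\<^sub>m n"
    unfolding D_eq E_def conjugate_mult_mat[OF W'(1,2,4) L I(1)] conjugate_mult_mat[OF W'(1,2,4) I(1) L]
    using W' I by simp_all
  then show "invertible_mat D"
    using D E by (auto simp: invertible_mat_def inverts_mat_def)
  have "mat_inv D = E" using D E DE by (rule mat_inv_eqI)
  moreover have "W * E * W\<^sup>T = mat_inv L"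
    unfolding E_def by (rule conjugate_conjugate_mat[OF W'(1,2,4) I(1)])
  ultimately show "mat_inv (W * D * W\<^sup>T) = W * mat_inv D * W\<^sup>T"
    by (simp add: L_def)
qed

text \<open>The vector on the left is row \<open>i\<close> of \<open>W\<close> times the inverse
  diagonal factor, by symmetry of that factor. The remaining right multiplication by
  \<open>W\<^sup>T\<close> completes the inverse and preserves row norms.\<close>

lemma norm2_row_mat_inv_diagonalized:
  assumes W: "orthogonal_real_mat n W" and inv: "invertible_mat (W * mat_diag n f * W\<^sup>T)" and i: "i < n"
  shows "norm2 (mat_inv (mat_diag n f) *\<^sub>v row W i) = norm2 (row (mat_inv (W * mat_diag n f * W\<^sup>T)) i)"
proof -
  let ?D = "mat_diag n f"
  have W': "W \<in> carrier_mat n n" using W by (auto simp: orthogonal_real_mat_def)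
  note D = orthogonally_similar_inverse[OF W mat_diag_dim inv]
  have E: "mat_inv ?D \<in> carrier_mat n n" by (rule mat_inv(1)[OF mat_diag_dim D(1)])
  have "mat_inv ?D *\<^sub>v row W i = row (W * (mat_inv ?D)\<^sup>T) i"
    using W' E i by (intro eq_vecI) (auto simp: comm_scalar_prod[of _ n])
  also have "(mat_inv ?D)\<^sup>T = mat_inv ?D"
    by (rule mat_inv_symmetric[OF mat_diag_dim D(1) transpose_mat_diag])
  finally show ?thesis
    unfolding D(2) using norm2_row_mult_transpose[OF mult_carrier_mat[OF W' E] W i] by simp
qed

text \<open>A zero row of \<open>B\<close> would put a 0 on the diagonal of
  \<open>B * mat_inv B\<close>. Positivity keeps the denominators in Hoeffding's inequality
  nonzero.\<close>

lemma L2_set_row_pos: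
  assumes B: "B \<in> carrier_mat n n" "invertible_mat B" and i: "i < n"
  shows "L2_set (\<lambda>j. B $$ (i, j)) {..<n} > 0"
proof (rule ccontr)
  assume "\<not> ?thesis"
  moreover have "L2_set (\<lambda>j. B $$ (i, j)) {..<n} \<ge> 0" by (rule L2_set_nonneg)
  ultimately have "L2_set (\<lambda>j. B $$ (i, j)) {..<n} = 0" by linarith
  then have "\<And>j. j < n \<Longrightarrow> B $$ (i, j) = 0"
    by (simp add: L2_set_eq_0_iff)
  moreover have "(B * mat_inv B) $$ (i, i) = (\<Sum>j<n. B $$ (i, j) * mat_inv B $$ (j, i))"
    using mat_inv(1)[OF B] B(1) i by (simp add: scalar_prod_def atLeast0LessThan)
  ultimately have "(B * mat_inv B) $$ (i, i) = 0" by simp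
  then show False using mat_inv(2)[OF B] i by simp
qed

section \<open>Deviations of the nodal voltages\<close>

theorem theorem1:
  shows "\<exists>C>0. \<forall>(n::nat) (G :: (nat, nat) pre_digraph) (r::real vec) (x::real vec) (\<kappa>::real)
      (L::real mat) (W::real mat) (eig :: nat \<Rightarrow> real)
      (S::nat set) (b::nat) (M :: 'a measure)
      (p_star::real vec) (p_tilde :: nat \<Rightarrow> 'a \<Rightarrow> real) (p_lo::real) (p_hi::real) (\<Delta>::real)
      (v_slack::real) (p :: 'a \<Rightarrow> real vec) (v :: 'a \<Rightarrow> real vec) (v_mean :: nat \<Rightarrow> real).
    radial_network n G \<longrightarrow>
    r \<in> carrier_vec n \<longrightarrow> x \<in> carrier_vec n \<longrightarrow> (\<forall>l<n. r $ l \<noteq> 0 \<and> x $ l \<noteq> 0) \<longrightarrow>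
    invertible_mat (RkX_mat n G r x \<kappa>) \<longrightarrow>
    L = L_mat n G r x \<kappa> \<longrightarrow>
    orthogonal_real_mat n W \<longrightarrow> L = W * mat_diag n eig * W\<^sup>T \<longrightarrow>
    S \<subseteq> {..<n} \<longrightarrow> S \<noteq> {} \<longrightarrow> b = card S \<longrightarrow>
    prob_space M \<longrightarrow>
    p_star \<in> carrier_vec n \<longrightarrow>
    prob_space.indep_vars M (\<lambda>_. borel) p_tilde {..<n} \<longrightarrow>
    (\<forall>i<n. AE \<omega> in M. p_lo \<le> p_tilde i \<omega> \<and> p_tilde i \<omega> \<le> p_hi) \<longrightarrow>
    \<Delta> = p_hi - p_lo \<longrightarrow> \<Delta> > 0 \<longrightarrow>
    (\<forall>\<omega>\<in>space M. p \<omega> = p_star + vec n (\<lambda>i. p_tilde i \<omega>)) \<longrightarrow>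
    (\<forall>\<omega>\<in>space M. v \<omega> = v_slack \<cdot>\<^sub>v vec n (\<lambda>_. 1) + mat_inv L *\<^sub>v p \<omega>) \<longrightarrow>
    (\<forall>i<n. v_mean i = (\<integral>\<omega>. v \<omega> $ i \<partial>M)) \<longrightarrow>
    (b \<ge> 2 \<longrightarrow>
      (\<integral>\<omega>. (MAX i\<in>S. \<bar>v \<omega> $ i - v_mean i\<bar>) \<partial>M)
        \<le> C * (1/2 * \<Delta> * (MAX i\<in>S. norm2 (mat_inv (mat_diag n eig) *\<^sub>v row W i))
              * sqrt (2 * ln (real b)))) \<and>
    (\<forall>\<epsilon>>0. measure M {\<omega> \<in> space M. (MAX i\<in>S. \<bar>v \<omega> $ i - v_mean i\<bar>) > \<epsilon>}
        \<le> 2 * real b * exp (- 2 * \<epsilon>\<^sup>2 /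
            (\<Delta>\<^sup>2 * (MAX i\<in>S. norm2 (mat_inv (mat_diag n eig) *\<^sub>v row W i))\<^sup>2)))"
proof (rule exI[of _ "sqrt 2"], intro conjI allI impI)
  show "sqrt 2 > (0::real)" by simp
next
  fix n G r x \<kappa> L W eig S b and M :: "'a measure"
    and p_star p_tilde p_lo p_hi \<Delta> v_slack p v v_mean
  assume inv_RkX: "invertible_mat (RkX_mat n G r x \<kappa>)" and L: "L = L_mat n G r x \<kappa>"
    and W: "orthogonal_real_mat n W" and L_eig: "L = W * mat_diag n eig * W\<^sup>T"
    and S: "S \<subseteq> {..<n}" "S \<noteq> {}" and b: "b = card S" and M: "prob_space M"
    and p_star: "p_star \<in> carrier_vec n"
    and p_tilde: "prob_space.indep_vars M (\<lambda>_. borel) p_tilde {..<n}"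
      "\<forall>i<n. AE \<omega> in M. p_lo \<le> p_tilde i \<omega> \<and> p_tilde i \<omega> \<le> p_hi"
    and \<Delta>: "\<Delta> = p_hi - p_lo" "\<Delta> > 0"
    and p: "\<forall>\<omega>\<in>space M. p \<omega> = p_star + vec n (\<lambda>i. p_tilde i \<omega>)"
    and v: "\<forall>\<omega>\<in>space M. v \<omega> = v_slack \<cdot>\<^sub>v vec n (\<lambda>_. 1) + mat_inv L *\<^sub>v p \<omega>"
    and v_mean: "\<forall>i<n. v_mean i = (\<integral>\<omega>. v \<omega> $ i \<partial>M)"
  interpret indep_common_interval M "{..<n}" p_tilde p_lo p_hi
    using M p_tilde \<Delta> by (simp add: indep_common_interval_def indep_common_interval_axioms_def)
  have finS: "finite S" using S(1) finite_subset by blast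
  have L_carrier: "L \<in> carrier_mat n n"
    using W unfolding L_eig orthogonal_real_mat_def by (intro mult_carrier_mat) auto
  have inv_L: "invertible_mat L"
  proof -
    \<comment> \<open>The dimension of \<open>RkX_mat\<close> is only visible through \<open>L = W \<Lambda> W\<^sup>T\<close>: \<open>mat_inv\<close> of a singular
       matrix is an unspecified matrix of unknown shape.\<close>
    have "RkX_mat n G r x \<kappa> \<in> carrier_mat (dim_row (RkX_mat n G r x \<kappa>)) (dim_row (RkX_mat n G r x \<kappa>))"
      using inv_RkX by (auto simp: invertible_mat_def)
    then show ?thesis
      unfolding L L_mat_def using inv_RkX by (rule invertible_mat_inv)
  qed
  define K where "K = mat_inv L"
  have K: "K \<in> carrier_mat n n" "invertible_mat K"
    using mat_inv(1)[OF L_carrier inv_L] invertible_mat_inv[OF L_carrier inv_L] by (simp_all add: K_def)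
  \<comment> \<open>Row \<open>i\<close> of the inverse of \<open>L\<close> holds the coefficients
    with which the random injections enter the voltage at node \<open>i\<close>.\<close>
  define c where "c i j = K $$ (i, j)" for i j
  have norm2_eq: "norm2 (mat_inv (mat_diag n eig) *\<^sub>v row W i) = L2_set (c i) {..<n}" if "i < n" for i
  proof -
    have "norm2 (mat_inv (mat_diag n eig) *\<^sub>v row W i) = norm2 (row K i)"
      using norm2_row_mat_inv_diagonalized[OF W inv_L[unfolded L_eig] that] by (simp add: K_def L_eig)
    also have "\<dots> = L2_set (c i) {..<n}"
      unfolding norm2_def using K(1) that by (intro L2_set_cong) (auto simp: c_def)
    finally show ?thesis .
  qed
  have pos: "L2_set (c i) {..<n} > 0" if "i \<in> S" for i
    unfolding c_def using L2_set_row_pos[OF K] S(1) that by auto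
  have dev: "v \<omega> $ i - v_mean i = deviation (c i) \<omega>" if i: "i < n" and \<omega>: "\<omega> \<in> space M" for i \<omega>
  proof -
    \<comment> \<open>The deterministic part, from the slack voltage and the nominal injections; it
      cancels against the same term in the mean.\<close>
    define a where "a = v_slack + (\<Sum>j<n. c i j * p_star $ j)"
    have v_i: "v \<omega> $ i = a + (\<Sum>j<n. c i j * p_tilde j \<omega>)" if "\<omega> \<in> space M" for \<omega>
      using that i K(1) p_star
      by (simp add: v p a_def c_def scalar_prod_def atLeast0LessThan sum.distrib ring_distribs flip: K_def)
    have "v_mean i = (\<integral>\<omega>. a + (\<Sum>j<n. c i j * p_tilde j \<omega>) \<partial>M)"
      using v_mean i v_i by (simp cong: Bochner_Integration.integral_cong)
    also have "\<dots> = a + (\<Sum>j<n. \<integral>\<omega>. c i j * p_tilde j \<omega> \<partial>M)"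
    proof -
      have int: "integrable M (\<lambda>\<omega>. c i j * p_tilde j \<omega>)" if "j \<in> {..<n}" for j
        using integrable_X[OF that] by simp
      show ?thesis
        using int by (subst Bochner_Integration.integral_add) (auto simp: Bochner_Integration.integral_sum prob_space)
    qed
    finally show ?thesis
      using v_i[OF \<omega>] by (simp add: deviation_def sum_subtractf)
  qed
  \<comment> \<open>The model fixes \<open>v\<close> on \<open>space M\<close> only, so this
    equation is later used through congruence rules for the integral and for the event.\<close>
  have Max_dev: "(MAX i\<in>S. \<bar>v \<omega> $ i - v_mean i\<bar>) = (MAX i\<in>S. \<bar>deviation (c i) \<omega>\<bar>)"
    if "\<omega> \<in> space M" for \<omega>
    using dev that S(1) by (intro arg_cong[of _ _ Max] image_cong) auto
  have Max_norm: "(MAX i\<in>S. norm2 (mat_inv (mat_diag n eig) *\<^sub>v row W i)) = (MAX i\<in>S. L2_set (c i) {..<n})"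
    using norm2_eq S(1) by (intro arg_cong[of _ _ Max] image_cong) auto
  show "(\<integral>\<omega>. (MAX i\<in>S. \<bar>v \<omega> $ i - v_mean i\<bar>) \<partial>M)
      \<le> sqrt 2 * (1/2 * \<Delta> * (MAX i\<in>S. norm2 (mat_inv (mat_diag n eig) *\<^sub>v row W i))
          * sqrt (2 * ln (real b)))" if "b \<ge> 2"
    unfolding Max_norm \<Delta>(1) b
    using Max_deviation_expectation_bound[where c = c, OF finS that[unfolded b] pos]
    by (simp only: Max_dev cong: Bochner_Integration.integral_cong)
  show "measure M {\<omega> \<in> space M. (MAX i\<in>S. \<bar>v \<omega> $ i - v_mean i\<bar>) > \<epsilon>}
      \<le> 2 * real b * exp (- 2 * \<epsilon>\<^sup>2 /
          (\<Delta>\<^sup>2 * (MAX i\<in>S. norm2 (mat_inv (mat_diag n eig) *\<^sub>v row W i))\<^sup>2))" if "\<epsilon> > 0" for \<epsilon>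
    unfolding Max_norm \<Delta>(1) b
    using Max_deviation_tail_bound[where c = c, OF finS S(2) pos less_imp_le[OF that]]
    by (simp only: Max_dev cong: conj_cong)
qed

end
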